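(* Let $Q$ be the ladder quiver of length $\ell\ge4$. For every central charge $\alpha:Q_0\to\mathbb R$ there exists at least one indecomposable object of $\mathrm{Rep}_{\mathrm{nf}}(Q)$ which is not $\alpha$-stable.
   Context: Fix a field $\mathbb F$; representations of a quiver $Q=(s,t:Q_1\to Q_0)$ are finite-dimensional over $\mathbb F$. A central charge is a function $\alpha:Q_0\to\mathbb R$. The $\alpha$-slope of a nonzero representation $V$ is $\mu_\alpha(V)=\frac{\sum_{x\in Q_0}\alpha(x)\dim V_x}{\sum_{x\in Q_0}\dim V_x}$. A nonzero $V$ is $\alpha$-stable if $\mu_\alpha(U)<\mu_\alpha(V)$ for every subrepresentation $U\subset V$ with $U\ne0,V$. The ladder quiver of length $\ell$ has vertices $x_0^+,\ldots,x_\ell^+,x_0^-,\ldots,x_\ell^-$ and edges $x_{i-1}^+\to x_i^+$, $x_{i-1}^-\to x_i^-$ ($1\le i\le\ell$) and $x_i^+\to x_i^-$ ($0\le i\le\ell$). A representation is equalised if any two directed paths with common source and common target induce the same linear map. For an equalised $V$ let $V^+$, $V^-$ be its restrictions to the top row ($x_i^+$) and bottom row ($x_i^-$). Each is a representation of a linearly oriented quiver $0\to1\to\cdots\to\ell$ and hence a direct sum, unique up to isomorphism and reordering, of interval modules $\mathbf I[a,b]$ ($0\le a\le b\le\ell$; $\mathbb F$ on $a,\ldots,b$ with identity maps, $0$ elsewhere); its barcode is the set of intervals occurring. $V$ is nestfree if neither barcode contains intervals $[a,b]$, $[c,d]$ with $a<c\le d<b$. $\mathrm{Rep}_{\mathrm{nf}}(Q)$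 is the full subcategory of nestfree equalised representations. *)

theory Defs
  imports Complex_Main "HOL-Library.Function_Algebras" "HOL-Library.FuncSet"
    "Graph_Theory.Arc_Walk"
begin

text \<open>A quiver is a directed multigraph, rendered as a record of type \<open>('x, 'e) pre_digraph\<close>.
  The vector spaces of a representation are finite-dimensional subspaces of one ambient
  vector space \<open>'v\<close> with scalar multiplication \<open>smul\<close>.\<close>

record ('x, 'e, 'f, 'v) qrep =
  smul :: "'f \<Rightarrow> 'v \<Rightarrow> 'v"
  space :: "'x \<Rightarrow> 'v set"
  arrow :: "'e \<Rightarrow> 'v \<Rightarrow> 'v"

definition linear_on ::
  "('f \<Rightarrow> 'v::plus \<Rightarrow> 'v) \<Rightarrow> ('f \<Rightarrow> 'w::plus \<Rightarrow> 'w) \<Rightarrow> 'v set \<Rightarrow> ('v \<Rightarrow> 'w) \<Rightarrow> bool"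
  where "linear_on s1 s2 S f \<longleftrightarrow>
    (\<forall>u\<in>S. \<forall>v\<in>S. f (u + v) = f u + f v) \<and> (\<forall>c. \<forall>u\<in>S. f (s1 c u) = s2 c (f u))"

definition representation ::
  "('x, 'e) pre_digraph \<Rightarrow> ('x, 'e, 'f::field, 'v::ab_group_add) qrep \<Rightarrow> bool"
  where "representation Q V \<longleftrightarrow>
    vector_space (smul V) \<and>
    (\<forall>x\<in>verts Q. module.subspace (smul V) (space V x) \<and>
       (\<exists>B. finite B \<and> space V x = module.span (smul V) B)) \<and>
    (\<forall>e\<in>arcs Q. arrow V e ` space V (tail Q e) \<subseteq> space V (head Q e) \<and>
       linear_on (smul V) (smul V) (space V (tail Q e)) (arrow V e))"

definition nonzero :: "('x, 'e) pre_digraph \<Rightarrow> ('x, 'e, 'f, 'v::zero) qrep \<Rightarrow> bool"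
  where "nonzero Q V \<longleftrightarrow> (\<exists>x\<in>verts Q. space V x \<noteq> {0})"

text \<open>Only the values of \<open>space\<close> at vertices and of \<open>arrow\<close> on these spaces are meaningful,
  so representations are never compared by equality of records.\<close>

definition subrepresentation :: "('x, 'e) pre_digraph \<Rightarrow>
    ('x, 'e, 'f::field, 'v::ab_group_add) qrep \<Rightarrow> ('x, 'e, 'f, 'v) qrep \<Rightarrow> bool"
  where "subrepresentation Q U V \<longleftrightarrow>
    representation Q U \<and> smul U = smul V \<and>
    (\<forall>x\<in>verts Q. space U x \<subseteq> space V x) \<and>
    (\<forall>e\<in>arcs Q. \<forall>u\<in>space U (tail Q e). arrow U e u = arrow V e u)"

definition isomorphic :: "('x, 'e) pre_digraph \<Rightarrow>
    ('x, 'e, 'f, 'v::plus) qrep \<Rightarrow> ('x, 'e, 'f, 'w::plus) qrep \<Rightarrow> bool"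
  where "isomorphic Q V W \<longleftrightarrow> (\<exists>\<phi>.
    (\<forall>x\<in>verts Q. bij_betw (\<phi> x) (space V x) (space W x) \<and>
       linear_on (smul V) (smul W) (space V x) (\<phi> x)) \<and>
    (\<forall>e\<in>arcs Q. \<forall>v\<in>space V (tail Q e).
       \<phi> (head Q e) (arrow V e v) = arrow W e (\<phi> (tail Q e) v)))"

text \<open>\<open>V\<close> is the (internal) direct sum of the finite family \<open>(W j)\<close>, \<open>j \<in> J\<close>, of
  subrepresentations.\<close>

definition direct_sum :: "('x, 'e) pre_digraph \<Rightarrow> ('x, 'e, 'f::field, 'v::ab_group_add) qrep \<Rightarrow>
    'j set \<Rightarrow> ('j \<Rightarrow> ('x, 'e, 'f, 'v) qrep) \<Rightarrow> bool"
  where "direct_sum Q V J W \<longleftrightarrow>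
    finite J \<and> (\<forall>j\<in>J. subrepresentation Q (W j) V) \<and>
    (\<forall>x\<in>verts Q. \<forall>v\<in>space V x. \<exists>!w. w \<in> (\<Pi>\<^sub>E j\<in>J. space (W j) x) \<and> v = (\<Sum>j\<in>J. w j))"

text \<open>Indecomposability in the full subcategory whose class of objects is \<open>C\<close>.\<close>

definition indecomposable_object :: "('x, 'e) pre_digraph \<Rightarrow>
    ('x, 'e, 'f::field, 'v::ab_group_add) qrep set \<Rightarrow> ('x, 'e, 'f, 'v) qrep \<Rightarrow> bool"
  where "indecomposable_object Q C V \<longleftrightarrow>
    V \<in> C \<and> nonzero Q V \<and>
    \<not> (\<exists>W::nat \<Rightarrow> ('x, 'e, 'f, 'v) qrep.
         (\<forall>j\<in>{0, 1}. W j \<in> C \<and> nonzero Q (W j)) \<and> direct_sum Q V {0, 1} W)"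

definition slope :: "('x, 'e) pre_digraph \<Rightarrow> ('x \<Rightarrow> real) \<Rightarrow>
    ('x, 'e, 'f::field, 'v::ab_group_add) qrep \<Rightarrow> real"
  where "slope Q \<alpha> V =
    (\<Sum>x\<in>verts Q. \<alpha> x * real (vector_space.dim (smul V) (space V x))) /
    (\<Sum>x\<in>verts Q. real (vector_space.dim (smul V) (space V x)))"

definition slope_stable :: "('x, 'e) pre_digraph \<Rightarrow> ('x \<Rightarrow> real) \<Rightarrow>
    ('x, 'e, 'f::field, 'v::ab_group_add) qrep \<Rightarrow> bool"
  where "slope_stable Q \<alpha> V \<longleftrightarrow>
    nonzero Q V \<and>
    (\<forall>U. subrepresentation Q U V \<and> nonzero Q U \<and> (\<exists>x\<in>verts Q. space U x \<noteq> space V x) \<longrightarrow>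
       slope Q \<alpha> U < slope Q \<alpha> V)"

text \<open>The map induced by a directed path \<open>p\<close>, given as its list of arcs, is \<open>fold (arrow V) p\<close>.\<close>

definition equalised :: "('x, 'e) pre_digraph \<Rightarrow> ('x, 'e, 'f, 'v) qrep \<Rightarrow> bool"
  where "equalised Q V \<longleftrightarrow>
    (\<forall>x y p q. pre_digraph.awalk Q x p y \<and> pre_digraph.awalk Q x q y \<longrightarrow>
       (\<forall>v\<in>space V x. fold (arrow V) p v = fold (arrow V) q v))"

datatype ladder_vertex = Plus nat | Minus nat

text \<open>\<open>PlusArc i\<close> and \<open>MinusArc i\<close> point from column \<open>i - 1\<close> to column \<open>i\<close>; \<open>DownArc i\<close> points
  from the top to the bottom row in column \<open>i\<close>.\<close>

datatype ladder_arc = PlusArc nat | MinusArc nat | DownArc nat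

fun ladder_tail :: "ladder_arc \<Rightarrow> ladder_vertex" where
  "ladder_tail (PlusArc i) = Plus (i - 1)"
| "ladder_tail (MinusArc i) = Minus (i - 1)"
| "ladder_tail (DownArc i) = Plus i"

fun ladder_head :: "ladder_arc \<Rightarrow> ladder_vertex" where
  "ladder_head (PlusArc i) = Plus i"
| "ladder_head (MinusArc i) = Minus i"
| "ladder_head (DownArc i) = Minus i"

definition ladder :: "nat \<Rightarrow> (ladder_vertex, ladder_arc) pre_digraph"
  where "ladder l =
    \<lparr>verts = Plus ` {0..l} \<union> Minus ` {0..l},
     arcs = PlusArc ` {1..l} \<union> MinusArc ` {1..l} \<union> DownArc ` {0..l},
     tail = ladder_tail, head = ladder_head\<rparr>"

definition linear_quiver :: "nat \<Rightarrow> (nat, nat) pre_digraph"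
  where "linear_quiver l = \<lparr>verts = {0..l}, arcs = {1..l}, tail = (\<lambda>i. i - 1), head = (\<lambda>i. i)\<rparr>"

lemma wf_digraph_ladder: "wf_digraph (ladder l)"
  by unfold_locales (auto simp: ladder_def)

lemma wf_digraph_linear_quiver: "wf_digraph (linear_quiver l)"
  by unfold_locales (auto simp: linear_quiver_def)

definition top_row :: "(ladder_vertex, ladder_arc, 'f, 'v) qrep \<Rightarrow> (nat, nat, 'f, 'v) qrep"
  where "top_row V =
    \<lparr>smul = smul V, space = (\<lambda>i. space V (Plus i)), arrow = (\<lambda>i. arrow V (PlusArc i))\<rparr>"

definition bottom_row :: "(ladder_vertex, ladder_arc, 'f, 'v) qrep \<Rightarrow> (nat, nat, 'f, 'v) qrep"
  where "bottom_row V =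
    \<lparr>smul = smul V, space = (\<lambda>i. space V (Minus i)), arrow = (\<lambda>i. arrow V (MinusArc i))\<rparr>"

text \<open>The arrow \<open>i\<close> goes from \<open>i - 1\<close> to \<open>i\<close>, so both ends lie in \<open>[a, b]\<close> iff \<open>a < i \<le> b\<close>.\<close>

definition interval_module :: "nat \<Rightarrow> nat \<Rightarrow> (nat, nat, 'f::field, 'f) qrep"
  where "interval_module a b =
    \<lparr>smul = (*),
     space = (\<lambda>i. if a \<le> i \<and> i \<le> b then UNIV else {0}),
     arrow = (\<lambda>i. if a < i \<and> i \<le> b then id else (\<lambda>_. 0))\<rparr>"

lemma representation_interval_module:
  "representation (linear_quiver l) (interval_module a b :: (nat, nat, 'f::field, 'f) qrep)"
proof -
  interpret F: vector_space "(*) :: 'f \<Rightarrow> 'f \<Rightarrow> 'f"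
    by unfold_locales (auto simp: algebra_simps)
  have "UNIV = F.span {1}"
    using F.span_singleton[of 1] by auto
  moreover have "{0} = F.span {}"
    by simp
  ultimately show ?thesis
    unfolding representation_def interval_module_def linear_quiver_def linear_on_def
    using F.vector_space_axioms F.subspace_UNIV F.subspace_0
    by (auto intro: exI[of _ "{1}"] exI[of _ "{}"])
qed

text \<open>The intervals occurring in a decomposition into interval modules. The multiset of these
  intervals does not depend on the decomposition (Krull--Schmidt), so nothing is added by
  collecting them over all decompositions.\<close>

definition barcode ::
  "nat \<Rightarrow> (nat, nat, 'f::field, 'v::ab_group_add) qrep \<Rightarrow> (nat \<times> nat) set"
  where "barcode l M = {I. \<exists>(n::nat) W a b.
    direct_sum (linear_quiver l) M {..<n} W \<and>
    (\<forall>j<n. a j \<le> b j \<and> b j \<le> l \<and>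
       isomorphic (linear_quiver l) (W j) (interval_module (a j) (b j))) \<and>
    (\<exists>j<n. I = (a j, b j))}"

definition nestfree ::
  "nat \<Rightarrow> (ladder_vertex, ladder_arc, 'f::field, 'v::ab_group_add) qrep \<Rightarrow> bool"
  where "nestfree l V \<longleftrightarrow>
    (\<forall>B\<in>{barcode l (top_row V), barcode l (bottom_row V)}.
       \<not> (\<exists>a b c d. (a, b) \<in> B \<and> (c, d) \<in> B \<and> a < c \<and> c \<le> d \<and> d < b))"

definition Rep_nf ::
  "nat \<Rightarrow> (ladder_vertex, ladder_arc, 'f::field, 'v::ab_group_add) qrep set"
  where "Rep_nf l = {V. representation (ladder l) V \<and> equalised (ladder l) V \<and> nestfree l V}"

end

theory Submission imports Defs begin

text \<open>For \<open>c \<le> a \<le> d \<le> b\<close> let \<open>R[a,b;c,d]\<close> be the thin representation with one-dimensional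
  spaces on \<open>[a, b]\<close> in the top row and on \<open>[c, d]\<close> in the bottom row and with identity maps inside
  this support. It is equalised, nestfree and indecomposable. Write \<open>p i\<close>, \<open>q i\<close> for the values
  of \<open>\<alpha>\<close> in the top and bottom row. If all of these are stable, then comparing
  \<open>R[1,4;0,1]\<close>, \<open>R[1,1;0,1]\<close>, \<open>R[2,3;1,2]\<close> with their subrepresentations supported on
  the bottom row, the last column and the last column together with the top row gives
  \<open>p 1 + p 2 + p 3 + p 4 > 2 q 0 + 2 q 1 > p 1 + 3 q 1 > p 1 + p 2 + p 3 + q 2\<close>,
  so \<open>q 2 < p 4\<close>. On the other hand \<open>R[3,4;2,3]\<close> and \<open>R[3,4;3,3]\<close> give
  \<open>3 q 2 > p 3 + q 3 + p 4 > 3 p 4\<close>.\<close>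

section \<open>Thin representations\<close>

definition scale_fun :: "'f::field \<Rightarrow> ('i \<Rightarrow> 'f) \<Rightarrow> 'i \<Rightarrow> 'f"
  where "scale_fun c v = (\<lambda>i. c * v i)"

interpretation fun_space: vector_space "scale_fun :: 'f::field \<Rightarrow> ('i \<Rightarrow> 'f) \<Rightarrow> 'i \<Rightarrow> 'f"
  by unfold_locales (auto simp: scale_fun_def algebra_simps fun_eq_iff)

text \<open>All one-dimensional spaces of a thin representation are this same line, so the identity
  serves as the map between any two of them. Constant functions require no distinguished index in
  \<open>'i\<close>.\<close>

definition const_line :: "('i \<Rightarrow> 'f::field) set"
  where "const_line = fun_space.span {\<lambda>_. 1}"

lemma one_fun_nonzero: "(\<lambda>_. 1 :: 'f::field) \<noteq> 0"
  by (auto simp: fun_eq_iff)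

lemma dim_const_line [simp]: "fun_space.dim (const_line :: ('i \<Rightarrow> 'f::field) set) = 1"
  unfolding const_line_def fun_space.dim_span
  using fun_space.dim_eq_card_independent[of "{\<lambda>_. 1 :: 'f}"] one_fun_nonzero
  by (simp add: fun_space.dependent_single)

lemma dim_zero_space [simp]: "fun_space.dim {0 :: 'i \<Rightarrow> 'f::field} = 0"
  by (metis card.empty fun_space.dim_eq_card_independent fun_space.dim_span
      fun_space.independent_empty fun_space.span_empty)

lemma const_line_neq_zero [simp]: "const_line \<noteq> {0 :: 'i \<Rightarrow> 'f::field}"
  using dim_const_line[where 'i='i and 'f='f] dim_zero_space[where 'i='i and 'f='f] by fastforce

text \<open>A nonzero element is \<open>c\<close> times the generator with \<open>c\<close>
  invertible, so rescaling recovers the generator. At each vertex, a subrepresentation of a thin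
  representation is thus all or nothing.\<close>

lemma subspace_const_line_cases:
  fixes A :: "('i \<Rightarrow> 'f::field) set"
  assumes "fun_space.subspace A" "A \<subseteq> const_line"
  shows "A = {0} \<or> A = const_line"
proof (cases "A = {0}")
  case False
  then obtain v where v: "v \<in> A" "v \<noteq> 0"
    using fun_space.subspace_0[OF assms(1)] by blast
  then obtain c where c: "v = scale_fun c (\<lambda>_. 1)"
    using assms(2) unfolding const_line_def fun_space.span_singleton by blast
  then have "c \<noteq> 0"
    using v by auto
  then have "(\<lambda>_. 1) = scale_fun (inverse c) v"
    unfolding c by (simp add: scale_fun_def)
  then have "(\<lambda>_. 1) \<in> A"
    using fun_space.subspace_scale[OF assms(1) v(1)] by metis
  then have "const_line \<subseteq> A"
    unfolding const_line_def using fun_space.span_minimal[OF _ assms(1)] by blast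
  then show ?thesis
    using assms(2) by blast
qed simp

section \<open>Thin representations, their subrepresentations and slopes\<close>

definition thin_rep ::
  "('x, 'e) pre_digraph \<Rightarrow> 'x set \<Rightarrow> ('x, 'e, 'f::field, 'i \<Rightarrow> 'f) qrep"
  where "thin_rep Q S =
    \<lparr>smul = scale_fun,
     space = (\<lambda>x. if x \<in> S then const_line else {0}),
     arrow = (\<lambda>e. if tail Q e \<in> S \<and> head Q e \<in> S then id else (\<lambda>_. 0))\<rparr>"

lemma thin_rep_simps [simp]:
  "smul (thin_rep Q S) = scale_fun"
  "space (thin_rep Q S) x = (if x \<in> S then const_line else {0})"
  "arrow (thin_rep Q S) e = (if tail Q e \<in> S \<and> head Q e \<in> S then id else (\<lambda>_. 0))"
  by (simp_all add: thin_rep_def)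

text \<open>The equation for \<open>V\<close> pins down the types \<open>'f\<close> and
  \<open>'i\<close>, which \<open>Q\<close> and \<open>S\<close> leave open.\<close>

lemma representation_thin_rep:
  fixes V :: "('x, 'e, 'f::field, 'i \<Rightarrow> 'f) qrep"
  assumes "V = thin_rep Q S"
  shows "representation Q V"
proof -
  have zero: "0 \<in> (const_line :: ('i \<Rightarrow> 'f) set)"
    by (simp add: const_line_def fun_space.span_zero)
  have sub: "fun_space.subspace (const_line :: ('i \<Rightarrow> 'f) set)"
    by (simp add: const_line_def)
  have span: "\<exists>B. finite B \<and> const_line = fun_space.span (B :: ('i \<Rightarrow> 'f) set)"
    unfolding const_line_def by blast
  have span0: "\<exists>B. finite B \<and> {0} = fun_space.span (B :: ('i \<Rightarrow> 'f) set)"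
    using fun_space.span_empty by blast
  have "linear_on scale_fun scale_fun A id"
    "linear_on scale_fun scale_fun A (\<lambda>_. 0 :: 'i \<Rightarrow> 'f)" for A :: "('i \<Rightarrow> 'f) set"
    by (simp_all add: linear_on_def)
  then show ?thesis
    unfolding representation_def assms thin_rep_simps
    using fun_space.vector_space_axioms zero sub span span0 by (auto simp: image_subset_iff)
qed

lemma nonzero_thin_rep: "nonzero Q (thin_rep Q S) \<longleftrightarrow> S \<inter> verts Q \<noteq> {}"
  by (auto simp: nonzero_def)

text \<open>An arrow from \<open>T\<close> into \<open>S\<close> is the identity in
  \<open>thin_rep Q S\<close>, so its head must stay in \<open>T\<close>; arrows leaving
  \<open>S\<close> are zero in both representations.\<close>

lemma subrepresentation_thin_rep:
  assumes "T \<subseteq> S"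
    and "\<And>e. e \<in> arcs Q \<Longrightarrow> tail Q e \<in> T \<Longrightarrow> head Q e \<in> S \<Longrightarrow> head Q e \<in> T"
  shows "subrepresentation Q (thin_rep Q T) (thin_rep Q S)"
  using assms unfolding subrepresentation_def
  by (auto simp: representation_thin_rep[OF refl] const_line_def fun_space.span_zero)

lemma slope_thin_rep:
  fixes V :: "('x, 'e, 'f::field, 'i \<Rightarrow> 'f) qrep"
  assumes "V = thin_rep Q S" "finite (verts Q)" "S \<subseteq> verts Q"
  shows "slope Q \<alpha> V = (\<Sum>x\<in>S. \<alpha> x) / card S"
proof -
  have "(\<Sum>x\<in>verts Q. g x * real (vector_space.dim (smul V) (space V x))) = (\<Sum>x\<in>S. g x)"
    for g :: "'x \<Rightarrow> real"
    using assms by (intro sum.mono_neutral_cong_right) auto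
  \<comment> \<open>Numerator and denominator of the slope are the same weighted sum, with weights
    \<alpha> and 1.\<close>
  from this[of \<alpha>] this[of "\<lambda>_. 1"] show ?thesis
    by (simp add: slope_def)
qed

text \<open>Clearing the positive denominators \<open>card T\<close> and \<open>card S\<close> turns
  stability into inequalities that are linear in the values of \<alpha>.\<close>

lemma slope_stable_thin_rep_less:
  fixes V :: "('x, 'e, 'f::field, 'i \<Rightarrow> 'f) qrep"
  assumes "V = thin_rep Q S" "slope_stable Q \<alpha> V"
    and "finite (verts Q)" "S \<subseteq> verts Q" "T \<subset> S" "T \<noteq> {}"
    and "\<And>e. e \<in> arcs Q \<Longrightarrow> tail Q e \<in> T \<Longrightarrow> head Q e \<in> S \<Longrightarrow> head Q e \<in> T"
  shows "(\<Sum>x\<in>T. \<alpha> x) * card S < (\<Sum>x\<in>S. \<alpha> x) * card T"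
proof -
  define U where "U = (thin_rep Q T :: ('x, 'e, 'f, 'i \<Rightarrow> 'f) qrep)"
  obtain x where x: "x \<in> S" "x \<notin> T" "x \<in> verts Q"
    using assms(4,5) by blast
  then have "space U x \<noteq> space V x"
    by (simp add: U_def assms(1) const_line_neq_zero[symmetric])
  moreover have "subrepresentation Q U V"
    unfolding U_def assms(1) using assms(5,7) by (intro subrepresentation_thin_rep) auto
  moreover have "nonzero Q U"
    using assms(4-6) by (auto simp: U_def nonzero_thin_rep)
  ultimately have "slope Q \<alpha> U < slope Q \<alpha> V"
    using assms(2) x(3) unfolding slope_stable_def by blast
  then have "(\<Sum>x\<in>T. \<alpha> x) / card T < (\<Sum>x\<in>S. \<alpha> x) / card S"
    using assms(3-5) slope_thin_rep[OF assms(1), of \<alpha>] slope_thin_rep[OF U_def, of \<alpha>]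
    by (simp add: psubset_imp_subset subset_trans)
  moreover have "card T > 0" "card S > 0"
    using assms(3-6) by (auto simp: card_gt_0_iff dest: finite_subset)
  ultimately show ?thesis
    by (simp add: field_simps)
qed

section \<open>Path maps and decompositions of thin representations\<close>

lemma fold_arrow_thin_rep_zero:
  fixes V :: "('x, 'e, 'f::field, 'i \<Rightarrow> 'f) qrep"
  assumes "V = thin_rep Q S"
  shows "fold (arrow V) p 0 = 0"
proof (induction p)
  case (Cons e p)
  have "arrow V e 0 = 0"
    by (simp add: assms)
  then show ?case
    using Cons.IH by (simp only: fold_simps)
qed simp

text \<open>Intersections of a successor-closed with a predecessor-closed set are the path-convex sets.\<close>

lemma equalised_thin_rep:
  fixes V :: "('x, 'e, 'f::field, 'i \<Rightarrow> 'f) qrep"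
  assumes V: "V = thin_rep Q (U \<inter> D)" and "wf_digraph Q"
    and up: "\<And>e. e \<in> arcs Q \<Longrightarrow> tail Q e \<in> U \<Longrightarrow> head Q e \<in> U"
    and down: "\<And>e. e \<in> arcs Q \<Longrightarrow> head Q e \<in> D \<Longrightarrow> tail Q e \<in> D"
  shows "equalised Q V"
proof -
  interpret wf_digraph Q by fact
  have D: "x \<in> D" if "awalk x p y" "y \<in> D" for x p y
    using that by (induction p arbitrary: x) (auto simp: awalk_Nil_iff awalk_Cons_iff dest: down)
  have fold_zero: "fold (arrow V) p 0 = 0" for p
    by (rule fold_arrow_thin_rep_zero[OF V])
  \<comment> \<open>The right-hand side depends on the endpoint \<open>y\<close> but not on the path
    \<open>p\<close>.\<close>
  have "fold (arrow V) p v = (if y \<in> U \<inter> D then v else 0)"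
    if "awalk x p y" "v \<in> space V x" for x y p v
    using that
  proof (induction p arbitrary: x)
    case Nil
    then show ?case
      by (auto simp: V awalk_Nil_iff split: if_splits)
  next
    case (Cons e p)
    then have e: "e \<in> arcs Q" "tail Q e = x" and p: "awalk (head Q e) p y"
      by (auto simp: awalk_Cons_iff)
    consider "x \<notin> U \<inter> D" | "x \<in> U \<inter> D" "head Q e \<in> U \<inter> D"
      | "x \<in> U \<inter> D" "head Q e \<notin> U \<inter> D"
      by blast
    then show ?case
    proof cases
      case 1
      then have "v = 0"
        using Cons.prems(2) by (auto simp: V split: if_splits)
      then show ?thesis
        using fold_zero[of "e # p"] by presburger
    next
      case 2
      then have "arrow V e v = v" "v \<in> space V (head Q e)"
        using Cons.prems(2) e(2) by (auto simp: V)
      then show ?thesis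
        using Cons.IH[OF p] by (simp only: fold_simps)
    next
      \<comment> \<open>The head stays in \<open>U\<close> because \<open>x\<close> lies there, so
        it has left \<open>D\<close>; a walk starting outside \<open>D\<close> cannot end in
        \<open>D\<close>.\<close>
      case 3
      then have "y \<notin> U \<inter> D" "arrow V e v = 0"
        using D[OF p] up[OF e(1)] e(2) by (auto simp: V)
      then show ?thesis
        using fold_zero[of p] by (simp only: fold_simps if_False)
    qed
  qed
  then show ?thesis
    unfolding equalised_def by metis
qed

text \<open>In a decomposition of a thin representation each vertex of the support belongs to exactly
  one summand, and adjacent vertices belong to the same one.\<close>

lemma indecomposable_object_thin_rep:
  fixes V :: "('x, 'e, 'f::field, 'i \<Rightarrow> 'f) qrep"
  assumes V: "V = thin_rep Q S" and "V \<in> C" "S \<subseteq> verts Q" "S \<noteq> {}"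
    and connected: "\<And>P x y. (\<And>e. e \<in> arcs Q \<Longrightarrow> tail Q e \<in> S \<Longrightarrow> head Q e \<in> S \<Longrightarrow>
        P (tail Q e) = P (head Q e)) \<Longrightarrow> x \<in> S \<Longrightarrow> y \<in> S \<Longrightarrow> P x \<Longrightarrow> P y"
  shows "indecomposable_object Q C V"
proof -
  have no_split: False if nz: "\<forall>j\<in>{0, 1}. nonzero Q (W j)" and ds: "direct_sum Q V {0, 1} W"
    for W :: "nat \<Rightarrow> ('x, 'e, 'f, 'i \<Rightarrow> 'f) qrep"
  proof -
    have thin_smul: "smul V = scale_fun"
      by (simp add: V)
    have sub: "representation Q (W j)" "smul (W j) = scale_fun"
      "\<forall>x\<in>verts Q. space (W j) x \<subseteq> space V x"
      "\<forall>e\<in>arcs Q. \<forall>u\<in>space (W j) (tail Q e). arrow (W j) e u = arrow V e u"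
      if "j \<in> {0, 1}" for j
      using ds that unfolding direct_sum_def subrepresentation_def thin_smul by blast+
    have subspace: "fun_space.subspace (space (W j) x)" if "j \<in> {0, 1}" "x \<in> verts Q" for j x
      using sub(1,2)[OF that(1)] that(2) unfolding representation_def by auto
    have full: "space (W j) x = {0} \<or> space (W j) x = const_line" if "j \<in> {0, 1}" "x \<in> S" for j x
    proof -
      have x: "x \<in> verts Q"
        using that(2) assms(3) by blast
      moreover have "space V x = const_line"
        using that(2) by (simp add: V)
      ultimately have "space (W j) x \<subseteq> const_line"
        using sub(3)[OF that(1)] by metis
      then show ?thesis
        by (rule subspace_const_line_cases[OF subspace[OF that(1) x]])
    qed
    have outside: "space (W j) x = {0}" if "j \<in> {0, 1}" "x \<in> verts Q" "x \<notin> S" for j x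
    proof -
      have "space V x = {0}"
        using that(3) by (simp add: V)
      then have "space (W j) x \<subseteq> {0}"
        using sub(3)[OF that(1)] that(2) by metis
      then show ?thesis
        using fun_space.subspace_0[OF subspace[OF that(1,2)]] by blast
    qed
    \<comment> \<open>By \<open>full\<close> and \<open>outside\<close>, \<open>A j\<close> is the
      support of \<open>W j\<close>.\<close>
    define A where "A j = {x \<in> S. space (W j) x = const_line}" for j
    have closed: "head Q e \<in> A j" if "j \<in> {0, 1}" "e \<in> arcs Q" "tail Q e \<in> A j" "head Q e \<in> S" for j e
    proof -
      have t: "tail Q e \<in> S" "space (W j) (tail Q e) = const_line"
        using that(3) by (auto simp: A_def)
      have "arrow (W j) e ` space (W j) (tail Q e) \<subseteq> space (W j) (head Q e)"
        using sub(1)[OF that(1)] that(2) unfolding representation_def by blast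
      moreover have "arrow (W j) e u = u" if "u \<in> space (W j) (tail Q e)" for u
        using bspec[OF bspec[OF sub(4)[OF \<open>j \<in> _\<close>] \<open>e \<in> arcs Q\<close>] that] t \<open>head Q e \<in> S\<close>
        by (simp add: V)
      ultimately have "const_line \<subseteq> space (W j) (head Q e)"
        using t by force
      then have "space (W j) (head Q e) = const_line"
        using full[OF that(1,4)] const_line_neq_zero
        by (metis const_line_def empty_iff fun_space.span_zero subset_singletonD)
      then show ?thesis
        using that(4) by (simp add: A_def)
    qed
    have exactly_one: "x \<in> A 0 \<longleftrightarrow> x \<notin> A 1" if x: "x \<in> S" for x
    proof -
      define v where "v = ((\<lambda>_. 1) :: 'i \<Rightarrow> 'f)"
      have v: "v \<in> const_line" "v \<noteq> 0"
        by (auto simp: v_def const_line_def fun_space.span_base one_fun_nonzero)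
      have "\<exists>!w. w \<in> (\<Pi>\<^sub>E j\<in>{0, 1}. space (W j) x) \<and> v = (\<Sum>j\<in>{0, 1}. w j)"
      proof -
        have "x \<in> verts Q" "v \<in> space V x"
          using x assms(3) v(1) by (auto simp: V)
        then show ?thesis
          using ds unfolding direct_sum_def by blast
      qed
      then obtain w where w: "w \<in> (\<Pi>\<^sub>E j\<in>{0, 1}. space (W j) x) \<and> v = (\<Sum>j\<in>{0, 1}. w j)"
        and uniq: "\<forall>w'. w' \<in> (\<Pi>\<^sub>E j\<in>{0, 1}. space (W j) x) \<and> v = (\<Sum>j\<in>{0, 1}. w' j) \<longrightarrow> w' = w"
        by (rule ex1E)
      have "x \<in> A 0 \<or> x \<in> A 1"
      proof (rule ccontr)
        assume "\<not> ?thesis"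
        then have "space (W 0) x = {0}" "space (W 1) x = {0}"
          using full x by (auto simp: A_def)
        then show False
          using w v(2) by (auto simp: PiE_iff)
      qed
      moreover have "\<not> (x \<in> A 0 \<and> x \<in> A 1)"
      proof
        assume "x \<in> A 0 \<and> x \<in> A 1"
        then have full: "space (W 0) x = const_line" "space (W 1) x = const_line"
          by (auto simp: A_def)
        have z: "0 \<in> (const_line :: ('i \<Rightarrow> 'f) set)"
          by (simp add: const_line_def fun_space.span_zero)
        \<comment> \<open>If both summands contained \<open>v\<close>, then \<open>v + 0\<close> and
          \<open>0 + v\<close> would be two decompositions of it. The extensional product forces the
          value \<open>undefined\<close> off the index set.\<close>
        let ?w0 = "\<lambda>j::nat. if j = 0 then v else if j = 1 then 0 else undefined"
        let ?w1 = "\<lambda>j::nat. if j = 0 then 0 else if j = 1 then v else undefined"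
        have w01: "?w0 = w" "?w1 = w"
          using full v z by (intro uniq[rule_format]; auto simp: PiE_iff extensional_def)+
        show False
          using fun_cong[OF trans[OF w01(1) w01(2)[symmetric]], of 0] v by simp
      qed
      ultimately show ?thesis
        by blast
    qed
    have meets: "\<exists>x. x \<in> S \<and> x \<in> A j" if j: "j \<in> {0, 1}" for j
      using nz j full[OF j] outside[OF j] unfolding nonzero_def A_def by blast
    obtain x y where "x \<in> S" "x \<in> A 0" "y \<in> S" "y \<in> A 1"
      using meets[of 0] meets[of 1] by auto
    \<comment> \<open>Arrows inside \<open>S\<close> carry both supports forward; since these are
      complementary in \<open>S\<close>, membership in \<open>A 0\<close> also passes
      backward.\<close>
    moreover have "tail Q e \<in> A 0 \<longleftrightarrow> head Q e \<in> A 0"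
      if "e \<in> arcs Q" "tail Q e \<in> S" "head Q e \<in> S" for e
      using closed[of 0 e] closed[of 1 e] exactly_one that by blast
    ultimately show False
      using connected[of "\<lambda>x. x \<in> A 0" x y] exactly_one by blast
  qed
  have "nonzero Q V"
    using assms(3,4) by (auto simp: V nonzero_thin_rep)
  with \<open>V \<in> C\<close> show ?thesis
    unfolding indecomposable_object_def
    by (elim conjI, intro conjI notI) (elim exE conjE, rule no_split, simp_all)
qed

section \<open>Interval summands\<close>

text \<open>The summand is one-dimensional at \<open>b\<close> and zero just after it, so a
  generator at \<open>b\<close> is killed by the next arrow. This locates right ends in any
  decomposition, without appeal to its uniqueness.\<close>

lemma barcode_right_end:
  fixes M :: "(nat, nat, 'f::field, 'v::ab_group_add) qrep"
  assumes "(a, b) \<in> barcode l M"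
  obtains w where "b \<le> l" "w \<in> space M b" "w \<noteq> 0" "b < l \<Longrightarrow> arrow M (Suc b) w = 0"
proof -
  let ?Q = "linear_quiver l"
  obtain n :: nat and W :: "nat \<Rightarrow> (nat, nat, 'f, 'v) qrep" and a' b' j where
    "direct_sum ?Q M {..<n} W" "j < n" "(a, b) = (a' j, b' j)"
    and "\<forall>j<n. a' j \<le> b' j \<and> b' j \<le> l \<and>
      isomorphic ?Q (W j) (interval_module (a' j) (b' j) :: (nat, nat, 'f, 'f) qrep)"
    using assms unfolding barcode_def by blast
  then have "\<exists>N. subrepresentation ?Q N M \<and>
      isomorphic ?Q N (interval_module a b :: (nat, nat, 'f, 'f) qrep) \<and> a \<le> b \<and> b \<le> l"
    unfolding direct_sum_def by (intro exI[of _ "W j"]) auto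
  then obtain N where N: "subrepresentation ?Q N M"
    and iso: "isomorphic ?Q N (interval_module a b :: (nat, nat, 'f, 'f) qrep)"
    and ab: "a \<le> b" "b \<le> l"
    by blast
  have rep: "representation ?Q N" and sub: "\<And>x. x \<le> l \<Longrightarrow> space N x \<subseteq> space M x"
    and arr: "\<And>i u. 1 \<le> i \<Longrightarrow> i \<le> l \<Longrightarrow> u \<in> space N (i - 1) \<Longrightarrow> arrow N i u = arrow M i u"
    using N unfolding subrepresentation_def by (auto simp: linear_quiver_def)
  obtain \<phi> where "\<forall>x\<in>verts ?Q.
      bij_betw (\<phi> x) (space N x) (space (interval_module a b :: (nat, nat, 'f, 'f) qrep) x)"
    using iso unfolding isomorphic_def by blast
  then have \<phi>: "bij_betw (\<phi> x) (space N x)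
      (space (interval_module a b :: (nat, nat, 'f, 'f) qrep) x)" if "x \<le> l" for x
    using that by (simp add: linear_quiver_def)
  have zero: "0 \<in> space N x" if "x \<le> l" for x
  proof -
    have "vector_space (smul N)" "module.subspace (smul N) (space N x)"
      using rep that unfolding representation_def by (auto simp: linear_quiver_def)
    then show ?thesis
      using module.subspace_0 module_iff_vector_space by blast
  qed
  have "bij_betw (\<phi> b) (space N b) (UNIV :: 'f set)"
    using \<phi>[of b] ab by (simp add: interval_module_def)
  \<comment> \<open>The preimages of 0 and 1 are distinct, so one of them is a nonzero
    vector.\<close>
  then obtain u v where "u \<in> space N b" "v \<in> space N b" "\<phi> b u = 0" "\<phi> b v = 1"
    unfolding bij_betw_def by (metis UNIV_I imageE)
  then obtain w where w: "w \<in> space N b" "w \<noteq> 0"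
    by (metis zero_neq_one)
  moreover have "arrow M (Suc b) w = 0" if "b < l"
  proof -
    have "bij_betw (\<phi> (Suc b)) (space N (Suc b)) {0}"
      using \<phi>[of "Suc b"] that by (simp add: interval_module_def)
    then have "card (space N (Suc b)) = 1"
      using bij_betw_same_card by fastforce
    then have "space N (Suc b) = {0}"
      using zero[of "Suc b"] that by (auto simp: card_1_singleton_iff)
    moreover have "arrow N (Suc b) w \<in> space N (Suc b)"
      using rep that w(1) unfolding representation_def by (fastforce simp: linear_quiver_def)
    ultimately show ?thesis
      using arr[of "Suc b" w] that w(1) by simp
  qed
  ultimately show ?thesis
    using that ab sub by blast
qed

section \<open>The indecomposables of the ladder\<close>

text \<open>This is the support of \<open>R[a,b;c,d]\<close>. Taking \<open>a > b\<close> or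
  \<open>c > d\<close> empties a row, which is how subrepresentations living in one row are
  written.\<close>

definition ladder_support :: "nat \<Rightarrow> nat \<Rightarrow> nat \<Rightarrow> nat \<Rightarrow> ladder_vertex set"
  where "ladder_support a b c d = Plus ` {a..b} \<union> Minus ` {c..d}"

lemma mem_ladder_support [simp]:
  "Plus i \<in> ladder_support a b c d \<longleftrightarrow> a \<le> i \<and> i \<le> b"
  "Minus i \<in> ladder_support a b c d \<longleftrightarrow> c \<le> i \<and> i \<le> d"
  by (auto simp: ladder_support_def)

lemma sum_ladder_support:
  "(\<Sum>x\<in>ladder_support a b c d. f x) = (\<Sum>i=a..b. f (Plus i)) + (\<Sum>i=c..d. f (Minus i))"
  unfolding ladder_support_def
  by (subst sum.union_disjoint) (auto simp: sum.reindex inj_on_def)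

text \<open>Truncated subtraction gives an empty interval the length 0, so supports in a single row
  are covered.\<close>

lemma card_ladder_support: "card (ladder_support a b c d) = (Suc b - a) + (Suc d - c)"
  using sum_ladder_support[of "\<lambda>_. 1 :: nat" a b c d] by simp

lemma ladder_support_subset_verts:
  "b \<le> l \<Longrightarrow> d \<le> l \<Longrightarrow> ladder_support a b c d \<subseteq> verts (ladder l)"
  by (auto simp: ladder_support_def ladder_def)

text \<open>An identity map kills no nonzero vector, so every interval in the top row ends at
  \<open>b\<close> and every one in the bottom row at \<open>d\<close>. Strictly nested intervals
  would have different right ends.\<close>

lemma nestfree_thin_rep_ladder_support:
  fixes V :: "(ladder_vertex, ladder_arc, 'f::field, 'i \<Rightarrow> 'f) qrep"
  assumes "V = thin_rep (ladder l) (ladder_support a b c d)" "b \<le> l" "d \<le> l"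
  shows "nestfree l V"
proof -
  have top: "j = b" if ij: "(i, j) \<in> barcode l (top_row V)" for i j
  proof -
    obtain w where "j \<le> l" "w \<in> space (top_row V) j" "w \<noteq> 0"
        "j < l \<Longrightarrow> arrow (top_row V) (Suc j) w = 0"
      by (rule barcode_right_end[OF ij]) (rule that; simp)
    then show ?thesis
      using assms by (cases "j < l") (auto simp: top_row_def ladder_def split: if_splits)
  qed
  have bottom: "j = d" if ij: "(i, j) \<in> barcode l (bottom_row V)" for i j
  proof -
    obtain w where "j \<le> l" "w \<in> space (bottom_row V) j" "w \<noteq> 0"
        "j < l \<Longrightarrow> arrow (bottom_row V) (Suc j) w = 0"
      by (rule barcode_right_end[OF ij]) (rule that; simp)
    then show ?thesis
      using assms by (cases "j < l") (auto simp: bottom_row_def ladder_def split: if_splits)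
  qed
  show ?thesis
    unfolding nestfree_def using top bottom by blast
qed

text \<open>The support is cut out by lower bounds \<open>?U\<close> and upper bounds
  \<open>?D\<close> on the columns. For the vertical arrows, \<open>c \<le> a\<close> makes
  \<open>?U\<close> closed under successors and \<open>d \<le> b\<close> makes \<open>?D\<close>
  closed under predecessors.\<close>

lemma equalised_thin_rep_ladder_support:
  assumes "c \<le> a" "d \<le> b"
  shows "equalised (ladder l) (thin_rep (ladder l) (ladder_support a b c d))"
proof -
  let ?U = "Plus ` {a..} \<union> Minus ` {c..}" and ?D = "Plus ` {..b} \<union> Minus ` {..d}"
  have "equalised (ladder l) (thin_rep (ladder l) (?U \<inter> ?D))"
    using assms by (intro equalised_thin_rep[OF refl] wf_digraph_ladder) (auto simp: ladder_def)
  moreover have "?U \<inter> ?D = ladder_support a b c d"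
    by (auto simp: ladder_support_def)
  ultimately show ?thesis
    by simp
qed

text \<open>Each row of the support is a path, and \<open>c \<le> a \<le> d \<le> b\<close> puts
  both ends of the vertical arrow in column \<open>a\<close> into the support, joining the
  rows.\<close>

lemma ladder_support_connected:
  assumes "c \<le> a" "a \<le> d" "d \<le> b" "b \<le> l"
    and P: "\<And>e. e \<in> arcs (ladder l) \<Longrightarrow> tail (ladder l) e \<in> ladder_support a b c d \<Longrightarrow>
      head (ladder l) e \<in> ladder_support a b c d \<Longrightarrow> P (tail (ladder l) e) = P (head (ladder l) e)"
    and "x \<in> ladder_support a b c d"
  shows "P x = P (Plus a)"
proof -
  have top: "i \<le> b \<longrightarrow> P (Plus i) = P (Plus a)" if "a \<le> i" for i
    using that
  proof (induction rule: dec_induct)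
    case (step i)
    then show ?case
      using P[of "PlusArc (Suc i)"] assms by (auto simp: ladder_def)
  qed simp
  have bottom: "i \<le> d \<longrightarrow> P (Minus i) = P (Minus c)" if "c \<le> i" for i
    using that
  proof (induction rule: dec_induct)
    case (step i)
    then show ?case
      using P[of "MinusArc (Suc i)"] assms by (auto simp: ladder_def)
  qed simp
  have "P (Plus a) = P (Minus a)"
    using P[of "DownArc a"] assms by (auto simp: ladder_def)
  moreover have "P (Minus a) = P (Minus c)"
    using bottom[of a] assms(1,2) by blast
  ultimately have "P (Minus c) = P (Plus a)"
    by metis
  then show ?thesis
    using top bottom \<open>x \<in> _\<close> by (cases x) (metis mem_ladder_support)+
qed

lemma indecomposable_thin_rep_ladder_support:
  fixes V :: "(ladder_vertex, ladder_arc, 'f::field, 'i \<Rightarrow> 'f) qrep"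
  assumes "V = thin_rep (ladder l) (ladder_support a b c d)" "c \<le> a" "a \<le> d" "d \<le> b" "b \<le> l"
  shows "indecomposable_object (ladder l) (Rep_nf l) V"
proof (rule indecomposable_object_thin_rep[OF assms(1)])
  show "V \<in> Rep_nf l"
  proof -
    have "d \<le> l"
      using assms by simp
    moreover have "equalised (ladder l) V"
      unfolding assms(1) using assms by (intro equalised_thin_rep_ladder_support)
    ultimately show ?thesis
      unfolding Rep_nf_def
      using representation_thin_rep[OF assms(1)] nestfree_thin_rep_ladder_support[OF assms(1,5)]
      by blast
  qed
  show "ladder_support a b c d \<subseteq> verts (ladder l)"
    using assms by (intro ladder_support_subset_verts) auto
  have "Plus a \<in> ladder_support a b c d"
    using assms by simp
  then show "ladder_support a b c d \<noteq> {}"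
    by blast
next
  fix P x y
  assume P: "\<And>e. e \<in> arcs (ladder l) \<Longrightarrow> tail (ladder l) e \<in> ladder_support a b c d \<Longrightarrow>
      head (ladder l) e \<in> ladder_support a b c d \<Longrightarrow> P (tail (ladder l) e) = P (head (ladder l) e)"
    and xy: "x \<in> ladder_support a b c d" "y \<in> ladder_support a b c d" and "P x"
  have "P z = P (Plus a)" if "z \<in> ladder_support a b c d" for z
    by (rule ladder_support_connected[where P=P, OF assms(2-5) _ that]) (rule P)
  then show "P y"
    using xy \<open>P x\<close> by metis
qed

section \<open>The incompatible slope inequalities\<close>

theorem proposition6p3:
  fixes l :: nat and \<alpha> :: "ladder_vertex \<Rightarrow> real"
  assumes "l \<ge> 4"
  shows "\<exists>V :: (ladder_vertex, ladder_arc, 'f::field, nat \<Rightarrow> 'f) qrep.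
    indecomposable_object (ladder l) (Rep_nf l) V \<and> \<not> slope_stable (ladder l) \<alpha> V"
proof (rule ccontr)
  assume "\<not> ?thesis"
  then have stable: "slope_stable (ladder l) \<alpha>
      (thin_rep (ladder l) (ladder_support a b c d) :: (_, _, 'f, nat \<Rightarrow> 'f) qrep)"
    if "c \<le> a" "a \<le> d" "d \<le> b" "b \<le> l" for a b c d
    using indecomposable_thin_rep_ladder_support[OF refl that] by blast
  \<comment> \<open>Horizontal arrows point right, so a subrepresentation arises by raising the left
    ends to \<open>a'\<close> and \<open>c'\<close>. Closure under the vertical arrows is the
    premise \<open>a' \<le> d \<Longrightarrow> c' \<le> a'\<close>: the first column at risk is
    \<open>a'\<close>.\<close>
  have less: "((\<Sum>i=a'..b. \<alpha> (Plus i)) + (\<Sum>i=c'..d. \<alpha> (Minus i))) * ((Suc b - a) + (Suc d - c))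
      < ((\<Sum>i=a..b. \<alpha> (Plus i)) + (\<Sum>i=c..d. \<alpha> (Minus i))) * ((Suc b - a') + (Suc d - c'))"
    if "c \<le> a" "a \<le> d" "d \<le> b" "b \<le> l" "a \<le> a'" "c \<le> c'" "a' \<le> d \<Longrightarrow> c' \<le> a'"
      "a < a' \<or> c < c'" "a' \<le> b \<or> c' \<le> d" for a b c d a' c'
  proof -
    let ?S = "ladder_support a b c d" and ?T = "ladder_support a' b c' d"
    have "Plus a \<in> ?S - ?T \<or> Minus c \<in> ?S - ?T" "?T \<subseteq> ?S"
      using that by (auto simp: ladder_support_def)
    then have "?T \<subset> ?S"
      by blast
    moreover have "?T \<noteq> {}"
      using that by (auto simp: ladder_support_def)
    ultimately have "(\<Sum>x\<in>?T. \<alpha> x) * card ?S < (\<Sum>x\<in>?S. \<alpha> x) * card ?T"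
      using that
      by (intro slope_stable_thin_rep_less[OF refl stable[OF that(1-4)]] ladder_support_subset_verts)
        (auto simp: ladder_def)
    then show ?thesis
      by (simp add: sum_ladder_support card_ladder_support)
  qed
  \<comment> \<open>The arguments of \<open>less\<close> follow first occurrence in its premises:
    \<open>c\<close>, \<open>a\<close>, \<open>d\<close>, \<open>b\<close>, \<open>a'\<close>,
    \<open>c'\<close>. Here \<open>a' = 5\<close> exceeds \<open>b = 4\<close>, which leaves only
    the bottom row; \<open>l \<ge> 4\<close> provides column 4.\<close>
  have "2 * \<alpha> (Minus 0) + 2 * \<alpha> (Minus 1)
      < \<alpha> (Plus 1) + \<alpha> (Plus 2) + \<alpha> (Plus 3) + \<alpha> (Plus 4)"
    using less[of 0 1 1 4 5 0] assms by (simp add: numeral_eq_Suc)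
  moreover have "\<alpha> (Plus 1) + \<alpha> (Minus 1) < 2 * \<alpha> (Minus 0)"
    using less[of 0 1 1 1 1 1] assms by (simp add: numeral_eq_Suc)
  moreover have "\<alpha> (Plus 2) + \<alpha> (Plus 3) + \<alpha> (Minus 2) < 3 * \<alpha> (Minus 1)"
    using less[of 1 2 2 3 2 2] assms by (simp add: numeral_eq_Suc)
  moreover have "\<alpha> (Plus 3) + \<alpha> (Plus 4) + \<alpha> (Minus 3) < 3 * \<alpha> (Minus 2)"
    using less[of 2 3 3 4 3 3] assms by (simp add: numeral_eq_Suc)
  \<comment> \<open>With \<open>c' = 4\<close> beyond \<open>d = 3\<close>, the subrepresentation is
    the single vertex \<open>Plus 4\<close>.\<close>
  moreover have "2 * \<alpha> (Plus 4) < \<alpha> (Plus 3) + \<alpha> (Minus 3)"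
    using less[of 3 3 3 4 4 4] assms by (simp add: numeral_eq_Suc)
  \<comment> \<open>Weights 3, 3, 3, 1, 1 on the five inequalities, in this order, make both sides
    equal.\<close>
  ultimately show False
    by linarith
qed

end
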